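(* Let $\lambda$ be a root of the polynomial $p(x)=x^n+a_{n-1}x^{n-1}+a_{n-2}x^{n-2}+\cdots+a_1x+a_0$. Let $P=\{P_1,P_2,\ldots,P_t\}$ be a partition of $\{0,1,\ldots,n-1\}$ into $t$ nonempty sets, with $\max\{i : i\in P_1\}\le n-t$. Then $$|\lambda|\le B_P=\max\left\{\sum_{i\in P_1}|a_i|,\ 1+\sum_{i\in P_2}|a_i|,\ \ldots,\ 1+\sum_{i\in P_t}|a_i|\right\}.$$
   Context: Here $p$ is a monic polynomial of degree $n$ with complex coefficients $a_0,\ldots,a_{n-1}$, and $|\cdot|$ denotes the modulus of a complex number.
   Formalization: The case t = 1 with n ≥ 2 is excluded, since there the claimed bound, the sum of all |a_i|, fails: x^2 − 1/4 has root 1/2, which exceeds 1/4. The case n = t = 1 is kept. *)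

theory Defs
  imports Complex_Main "HOL-Library.Disjoint_Sets" "HOL-Computational_Algebra.Polynomial"
begin

definition monic_poly :: "nat \<Rightarrow> (nat \<Rightarrow> complex) \<Rightarrow> complex poly" where
  "monic_poly n a = monom 1 n + (\<Sum>i<n. monom (a i) i)"

text \<open>The blocks are labelled, since the first one plays a special role;
  injectivity of the labelling makes \<open>t\<close> the number of blocks. Nonemptiness of the
  blocks is part of \<^const>\<open>partition_on\<close>.\<close>

definition indexed_partition :: "nat set \<Rightarrow> nat \<Rightarrow> (nat \<Rightarrow> nat set) \<Rightarrow> bool" where
  "indexed_partition A t P \<longleftrightarrow> inj_on P {1..t} \<and> partition_on A (P ` {1..t})"

text \<open>For \<open>t = 1\<close> only the first block's sum remains, without the summand 1. This bounds the
  roots for \<open>n = 1\<close> but not for \<open>n \<ge> 2\<close>: the root \<open>1/2\<close> of \<open>x\<^sup>2 - 1/4\<close> exceeds \<open>1/4\<close>.\<close>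

definition partition_bound :: "(nat \<Rightarrow> complex) \<Rightarrow> nat \<Rightarrow> (nat \<Rightarrow> nat set) \<Rightarrow> real" where
  "partition_bound a t P =
     Max (insert (\<Sum>i\<in>P 1. cmod (a i)) ((\<lambda>j. 1 + (\<Sum>i\<in>P j. cmod (a i))) ` {2..t}))"

end

theory Submission imports Defs begin

text \<open>Suppose \<open>r = |\<lambda>| > B\<^sub>P\<close>, where \<open>t \<ge> 2\<close> and hence \<open>r > 1\<close>, and write
  \<open>s\<^sub>j = \<Sum>i\<in>P\<^sub>j. |a\<^sub>i|\<close>. Then \<open>|\<Sum>i<n. a\<^sub>i \<lambda>\<^sup>i| \<le> \<Sum>j. s\<^sub>j r ^ max P\<^sub>j\<close>, with \<open>s\<^sub>1 < r\<close> and
  \<open>s\<^sub>j < r - 1\<close> for \<open>j \<ge> 2\<close>. The exponents \<open>max P\<^sub>j\<close> for \<open>j \<ge> 2\<close> are \<open>t - 1\<close> distinct numbers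
  below \<open>n\<close>, so the sum is less than \<open>r r\<^sup>n\<^sup>-\<^sup>t + (r - 1) (r ^ (n - t + 1) + \<dots> + r ^ (n - 1))\<close>,
  which telescopes to \<open>r ^ n\<close>, contradicting \<open>p(\<lambda>) = 0\<close>.\<close>

text \<open>The left side is greatest when \<open>S\<close> consists of the \<open>card S\<close>
  largest exponents below \<open>n\<close>, and there it telescopes to the right side.\<close>

lemma sum_distinct_powers_le:
  fixes r :: "'a::linordered_idom"
  assumes "1 \<le> r" and "S \<subseteq> {..<n}"
  shows "(r - 1) * (\<Sum>i\<in>S. r ^ i) \<le> r ^ n - r ^ (n - card S)"
  using assms(2)
proof (induction n arbitrary: S)
  case 0
  then show ?case by simp
next
  case (Suc n)
  have fin: "finite S" using Suc.prems finite_subset by blast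
  show ?case
  proof (cases "n \<in> S")
    case True
    have sub: "S - {n} \<subseteq> {..<n}" using Suc.prems by auto
    \<comment> \<open>Removing \<open>n\<close> lowers the range and the cardinality together, so
      the subtracted power is unchanged; the term \<open>(r - 1) * r ^ n\<close> then raises
      \<open>r ^ n\<close> to \<open>r ^ Suc n\<close>.\<close>
    have "card S > 0" using True fin card_gt_0_iff by blast
    then have "n - card (S - {n}) = Suc n - card S"
      using True fin by (simp add: card_Diff_singleton)
    then have "(r - 1) * (\<Sum>i\<in>S - {n}. r ^ i) \<le> r ^ n - r ^ (Suc n - card S)"
      using Suc.IH[OF sub] by simp
    then show ?thesis
      using True fin by (simp add: sum.remove algebra_simps)
  next
    case False
    have sub: "S \<subseteq> {..<n}" using Suc.prems False by (auto simp: less_Suc_eq)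
    have "card S \<le> n" using card_mono[OF _ sub] by simp
    then have suc: "Suc n - card S = Suc (n - card S)" by simp
    \<comment> \<open>Here the bound for \<open>Suc n\<close> is \<open>r\<close> times the
      nonnegative bound for \<open>n\<close>.\<close>
    have "r ^ (n - card S) \<le> r ^ n" using assms(1) by (intro power_increasing) auto
    then have "r ^ n - r ^ (n - card S) \<le> r * (r ^ n - r ^ (n - card S))"
      using assms(1) by (simp add: mult_le_cancel_right1)
    then show ?thesis using Suc.IH[OF sub] by (simp add: suc algebra_simps)
  qed
qed

lemma poly_monic_poly: "poly (monic_poly n a) z = z ^ n + (\<Sum>i<n. a i * z ^ i)"
  by (simp add: monic_poly_def poly_sum poly_monom)

lemma indexed_partitionD:
  assumes "indexed_partition A t P"
  shows "\<And>j. j \<in> {1..t} \<Longrightarrow> P j \<noteq> {}"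
    and "\<And>j. j \<in> {1..t} \<Longrightarrow> P j \<subseteq> A"
    and "\<And>j k. j \<in> {1..t} \<Longrightarrow> k \<in> {1..t} \<Longrightarrow> j \<noteq> k \<Longrightarrow> P j \<inter> P k = {}"
    and "(\<Union>j\<in>{1..t}. P j) = A"
proof -
  have inj: "inj_on P {1..t}" and part: "partition_on A (P ` {1..t})"
    using assms by (auto simp: indexed_partition_def)
  show "P j \<noteq> {}" if "j \<in> {1..t}" for j
    using part that by (metis imageI partition_onD3)
  show un: "(\<Union>j\<in>{1..t}. P j) = A"
    using part by (simp add: partition_on_def)
  then show "P j \<subseteq> A" if "j \<in> {1..t}" for j
    using that by blast
  \<comment> \<open>Injectivity turns distinct labels into distinct, hence disjoint, blocks.\<close>
  show "P j \<inter> P k = {}" if "j \<in> {1..t}" "k \<in> {1..t}" "j \<noteq> k" for j k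
    using disjointD[OF partition_onD2[OF part]] inj that by (metis imageI inj_onD)
qed

lemma norm_sum_block_le:
  fixes a :: "nat \<Rightarrow> 'a::real_normed_div_algebra"
  assumes "finite S" and "1 \<le> norm z"
  shows "norm (\<Sum>i\<in>S. a i * z ^ i) \<le> (\<Sum>i\<in>S. norm (a i)) * norm z ^ Max S"
  unfolding sum_distrib_right using assms
  by (intro sum_norm_le) (simp add: norm_mult norm_power mult_left_mono power_increasing)

theorem theorem5p2:
  fixes n t :: nat and a :: "nat \<Rightarrow> complex" and P :: "nat \<Rightarrow> nat set" and z :: complex
  assumes root: "poly (monic_poly n a) z = 0"
    and partition: "indexed_partition {0..<n} t P"
    and first_block: "Max (P 1) + t \<le> n"
    and nondegenerate: "2 \<le> t \<or> n = 1"
  shows "cmod z \<le> partition_bound a t P"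
proof (rule ccontr)
  define r where "r = cmod z"
  define s where "s j = (\<Sum>i\<in>P j. cmod (a i))" for j
  assume "\<not> ?thesis"
  then have s1: "s 1 < r" and sj: "\<And>j. j \<in> {2..t} \<Longrightarrow> 1 + s j < r"
    by (auto simp: partition_bound_def r_def s_def not_le)
  note P = indexed_partitionD[OF partition]
  have fin: "finite (P j)" if "j \<in> {1..t}" for j
    using P(2)[OF that] finite_subset by blast
  have eq: "r ^ n = cmod (\<Sum>i<n. a i * z ^ i)"
    using root unfolding poly_monic_poly r_def
    by (metis add_eq_0_iff2 norm_minus_cancel norm_power)
  show False
  proof (cases "2 \<le> t")
    case False
    with nondegenerate have n: "n = 1" and "t \<le> 1" by auto
    \<comment> \<open>\<open>t = 0\<close> would make the union empty. With the single block
      \<open>{0}\<close> the root is \<open>- a 0\<close>, so \<open>r = s 1\<close>.\<close>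
    with P(4) have t: "t = 1" by (cases t) auto
    have "P 1 = {0}" using P(4) by (simp add: t n)
    then show False using s1 eq by (simp add: s_def n)
  next
    case True
    have s0: "s j \<ge> 0" for j by (simp add: s_def sum_nonneg)
    have r1: "1 < r" using sj[of 2] s0[of 2] True by simp
    have split: "{1..t} = insert 1 {2..t}" using True by auto
    let ?M = "\<lambda>j. Max (P j)"
    have M: "?M j \<in> P j" if "j \<in> {1..t}" for j
      using Max_in[OF fin[OF that] P(1)[OF that]] .
    \<comment> \<open>A common maximum would lie in two disjoint blocks.\<close>
    have inj: "inj_on ?M {2..t}"
    proof (rule inj_onI, rule ccontr)
      fix j k assume "j \<in> {2..t}" "k \<in> {2..t}" "?M j = ?M k" "j \<noteq> k"
      then show False using M[of j] M[of k] P(3)[of j k] by auto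
    qed
    have sub: "?M ` {2..t} \<subseteq> {..<n}"
    proof (rule image_subsetI)
      fix j assume "j \<in> {2..t}"
      then have j: "j \<in> {1..t}" by simp
      show "?M j \<in> {..<n}" using M[OF j] P(2)[OF j] by auto
    qed
    have "(\<Sum>i<n. a i * z ^ i) = (\<Sum>i\<in>(\<Union>j\<in>{1..t}. P j). a i * z ^ i)"
      by (simp only: P(4) atLeast0LessThan)
    also have "\<dots> = (\<Sum>j\<in>{1..t}. \<Sum>i\<in>P j. a i * z ^ i)"
      using fin P(3) by (intro sum.UNION_disjoint) auto
    finally have "r ^ n \<le> (\<Sum>j\<in>{1..t}. cmod (\<Sum>i\<in>P j. a i * z ^ i))"
      unfolding eq by (simp add: norm_sum)
    also have "\<dots> \<le> (\<Sum>j\<in>{1..t}. s j * r ^ ?M j)"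
      unfolding s_def r_def using r1 fin
      by (intro sum_mono norm_sum_block_le) (auto simp: r_def)
    also have "\<dots> = s 1 * r ^ ?M 1 + (\<Sum>j\<in>{2..t}. s j * r ^ ?M j)"
      unfolding split by simp
    also have "\<dots> < r * r ^ (n - t) + (r - 1) * (\<Sum>i\<in>?M ` {2..t}. r ^ i)"
    \<comment> \<open>The strict inequality comes from the first block: \<open>s 1 < r\<close> and
      \<open>r ^ (n - t) > 0\<close>.\<close>
    proof (rule add_less_le_mono)
      have "s 1 * r ^ ?M 1 \<le> s 1 * r ^ (n - t)"
        using r1 s0 first_block by (intro mult_left_mono power_increasing) auto
      also have "\<dots> < r * r ^ (n - t)" using s1 r1 by simp
      finally show "s 1 * r ^ ?M 1 < r * r ^ (n - t)" .
      show "(\<Sum>j\<in>{2..t}. s j * r ^ ?M j) \<le> (r - 1) * (\<Sum>i\<in>?M ` {2..t}. r ^ i)"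
        unfolding sum.reindex[OF inj] sum_distrib_left o_def
        using sj r1 by (intro sum_mono mult_right_mono) (auto simp: less_imp_le algebra_simps)
    qed
    also have "\<dots> \<le> r * r ^ (n - t) + (r ^ n - r ^ (n - (t - 1)))"
      using sum_distinct_powers_le[OF less_imp_le[OF r1] sub] by (simp add: card_image[OF inj])
    \<comment> \<open>As \<open>t \<le> n\<close> by \<open>first_block\<close>, the subtraction is
      not truncated; the power left over by the \<open>t - 1\<close> maxima cancels
      \<open>r * r ^ (n - t)\<close>.\<close>
    also have "n - (t - 1) = Suc (n - t)" using True first_block by simp
    finally show False by simp
  qed
qed

end
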